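(* Let $\Psi_{\rm data},\Psi_{\rm prior}:\mathbb{R}^D\to\mathbb{R}$ be given, and for $\tau\in[0,1]$ let $\pi_\tau(\theta)\propto \exp(-\tau\Psi_{\rm data}(\theta))\,\pi_{\rm prior}(\theta)$ with $\pi_{\rm prior}\propto\exp(-\Psi_{\rm prior})$, and let $\Sigma_\tau$ be the covariance matrix of $\pi_\tau$. Let $V_\tau:\mathbb{R}^D\to\mathbb{R}$ satisfy the elliptic PDE $$\nabla_\theta\cdot(\pi_\tau\Sigma_\tau\nabla_\theta V_\tau) = -(\Psi_{\rm data}-\pi_\tau[\Psi_{\rm data}])\,\pi_\tau .$$ Then the choice $F_\tau(\theta)=\Sigma_\tau\nabla_\theta V_\tau(\theta)$ leads to an affine-invariant homotopy formulation $\frac{\rm d}{{\rm d}\tau}\theta_\tau=-F_\tau(\theta_\tau)$, $\theta_0\sim\pi_{\rm prior}$. More precisely, for any invertible $A\in\mathbb{R}^{D\times D}$ and $b\in\mathbb{R}^D$, with $\theta=A\overline{\theta}+b$, $\overline{\Psi}_{\rm data}(\overline\theta)=\Psi_{\rm data}(A\overline\theta+b)$, $\overline{\Psi}_{\rm prior}(\overline\theta)=\Psi_{\rm prior}(A\overline\theta+b)$, $\overline{\pi}_\tau(\overline\theta)=\pi_\tau(A\overline\theta+b)\,|A|$ and $\overline\Sigma_\tau$ the covariance matrix of $\overline\pi_\tau$, the transformed vector field is $\overline F_\tau(\overline\theta)=\overline\Sigma_\tau\nabla_{\overline\theta}\overline V_\tau(\overline\theta)$, where $\overline V_\tau$ satisfies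 $$\nabla_{\overline\theta}\cdot(\overline\pi_\tau\overline\Sigma_\tau\nabla_{\overline\theta}\overline V_\tau) = -(\overline\Psi_{\rm data}-\overline\pi_\tau[\overline\Psi_{\rm data}])\,\overline\pi_\tau ,$$ and $F_\tau(A\overline\theta+b)=A\,\overline F_\tau(\overline\theta)$ for all $\overline\theta\in\mathbb{R}^D$.
   Context: $\pi_\tau[f]$ denotes the expectation of $f$ under the PDF $\pi_\tau$. A homotopy formulation $\frac{\rm d}{{\rm d}\tau}\theta_\tau=-F_\tau(\theta_\tau)$ (with $F_\tau$ any vector field satisfying $\nabla_\theta\cdot(\pi_\tau F_\tau)=-(\Psi_{\rm data}-\pi_\tau[\Psi_{\rm data}])\pi_\tau$) is called affine-invariant if, for every invertible affine transformation $\theta=A\overline\theta+b$, the vector field $F_\tau$ of the original problem and the vector field $\overline F_\tau$ of the transformed problem (defined by $\overline\Psi_{\rm data},\overline\Psi_{\rm prior}$ as in the claim) satisfy $F_\tau(A\overline\theta+b)=A\overline F_\tau(\overline\theta)$; this implies $\theta_\tau=A\overline\theta_\tau+b$ for all $\tau>0$ if it holds at $\tau=0$. *)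

theory Defs
  imports "HOL-Analysis.Analysis"
begin

text \<open>Points of R^D are vectors real^'n (D = CARD('n)); matrices are real^'n^'n.\<close>

text \<open>Gradient of a scalar field: components are the directional (Frechet) derivatives
  along the coordinate axes.\<close>
definition grad :: "(real^'n \<Rightarrow> real) \<Rightarrow> real^'n \<Rightarrow> real^'n" where
  "grad V x = (\<chi> i. frechet_derivative V (at x) (axis i 1))"

text \<open>Divergence of a vector field.\<close>
definition divergence :: "(real^'n \<Rightarrow> real^'n) \<Rightarrow> real^'n \<Rightarrow> real" where
  "divergence G x = (\<Sum>i\<in>UNIV. (frechet_derivative G (at x) (axis i 1)) $ i)"

text \<open>The tempered posterior density
  pi_tau(theta) = exp(-tau Psi_data(theta)) exp(-Psi_prior(theta)) / Z_tau.\<close>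
definition post :: "(real^'n \<Rightarrow> real) \<Rightarrow> (real^'n \<Rightarrow> real) \<Rightarrow> real \<Rightarrow> real^'n \<Rightarrow> real" where
  "post Psi_data Psi_prior \<tau> \<theta> =
     exp (- \<tau> * Psi_data \<theta> - Psi_prior \<theta>) /
     (\<integral>x. exp (- \<tau> * Psi_data x - Psi_prior x) \<partial>lborel)"

text \<open>Expectation p[f] of f under a density p (w.r.t. Lebesgue measure).\<close>
definition expect :: "(real^'n \<Rightarrow> real) \<Rightarrow> (real^'n \<Rightarrow> real) \<Rightarrow> real" where
  "expect p f = (\<integral>x. p x * f x \<partial>lborel)"

definition mean :: "(real^'n \<Rightarrow> real) \<Rightarrow> real^'n" where
  "mean p = (\<chi> i. expect p (\<lambda>x. x $ i))"

text \<open>Covariance matrix of the density p.\<close>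
definition cov :: "(real^'n \<Rightarrow> real) \<Rightarrow> real^'n^'n" where
  "cov p = (\<chi> i j. expect p (\<lambda>x. (x $ i - mean p $ i) * (x $ j - mean p $ j)))"

text \<open>The vector field F(theta) = Sigma grad V(theta) attached to density p and potential V.\<close>
definition Fvec :: "(real^'n \<Rightarrow> real) \<Rightarrow> (real^'n \<Rightarrow> real) \<Rightarrow> real^'n \<Rightarrow> real^'n" where
  "Fvec p V \<theta> = cov p *v grad V \<theta>"

text \<open>V is a classical solution of the elliptic PDE
  div(p Sigma_p grad V) = -(Psi - p[Psi]) p  on all of R^D.\<close>
definition solves_pde :: "(real^'n \<Rightarrow> real) \<Rightarrow> (real^'n \<Rightarrow> real) \<Rightarrow> (real^'n \<Rightarrow> real) \<Rightarrow> bool" where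
  "solves_pde Psi p V \<longleftrightarrow>
     (\<forall>\<theta>. V differentiable (at \<theta>)) \<and>
     (\<forall>\<theta>. (\<lambda>x. p x *\<^sub>R Fvec p V x) differentiable (at \<theta>)) \<and>
     (\<forall>\<theta>. divergence (\<lambda>x. p x *\<^sub>R Fvec p V x) \<theta> = - (Psi \<theta> - expect p Psi) * p \<theta>)"

end

theory Submission
  imports Defs
begin

text \<open>Write \<theta> = A \<theta>' + b. By change of variables \<theta>' has density p(A \<theta>' + b) |det A|,
  with mean A\<inverse>(m - b) and covariance A\<inverse> \<Sigma> A\<inverse>^T, and expectations of functions of \<theta>
  are unchanged. The gradient of V(A \<theta>' + b) picks up a factor A^T, so the new field is
  A\<inverse> \<Sigma> A\<inverse>^T A^T \<nabla>V = A\<inverse> F. The transformed flux is therefore |det A| A\<inverse> (p F)(A \<theta>' + b);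
  its Jacobian |det A| A\<inverse> J A has the trace of |det A| J, so its divergence is |det A| times
  the right-hand side of the original equation at A \<theta>' + b, which is the right-hand side
  of the transformed equation.\<close>

section \<open>Lebesgue measure under invertible affine maps\<close>

definition vec_reindex :: "('m \<Rightarrow> 'n) \<Rightarrow> 'a^'n \<Rightarrow> 'a^'m" where
  "vec_reindex r x = (\<chi> j. x $ r j)"

lemma linear_vec_reindex: "linear (vec_reindex r :: real^'n::finite \<Rightarrow> real^'m::finite)"
  by (intro linearI) (simp_all add: vec_reindex_def vec_eq_iff)

lemma borel_measurable_vec_reindex [measurable]:
  "(vec_reindex r :: real^'n::finite \<Rightarrow> real^'m::finite) \<in> borel_measurable borel"
  using linear_vec_reindex[of r]
  by (intro borel_measurable_continuous_onI linear_continuous_on) (simp add: linear_linear)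

lemma emeasure_lborel_box_cart:
  fixes l u :: "real^'n::finite"
  assumes "\<And>j. l $ j \<le> u $ j"
  shows "emeasure lborel (box l u) = (\<Prod>j\<in>UNIV. (u - l) $ j)"
  using assms by (simp add: emeasure_lborel_box_eq Basis_vec_def cart_eq_inner_axis axis_eq_axis
      prod.UNION_disjoint)

lemma lborel_distr_vec_reindex:
  fixes r :: "'m::finite \<Rightarrow> 'n::finite"
  assumes "bij r"
  shows "distr lborel borel (vec_reindex r) = (lborel :: (real^'m) measure)"
proof (rule lborel_eqI[symmetric])
  fix l u :: "real^'m"
  assume box_le: "\<And>b. b \<in> Basis \<Longrightarrow> l \<bullet> b \<le> u \<bullet> b"
  have le: "l $ j \<le> u $ j" for j
    using box_le[of "axis j 1"] by (simp add: inner_axis)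
  let ?s = "vec_reindex (inv r)"
  have "vec_reindex r -` box l u = box (?s l) (?s u)"
    using assms by (auto simp: mem_box_cart vec_reindex_def) (metis bij_inv_eq_iff)+
  then have "emeasure (distr lborel borel (vec_reindex r)) (box l u)
      = emeasure lborel (box (?s l) (?s u))"
    by (simp add: emeasure_distr)
  also have "\<dots> = (\<Prod>i\<in>UNIV. (u - l) $ inv r i)"
    using le by (simp add: emeasure_lborel_box_cart vec_reindex_def)
  also have "\<dots> = (\<Prod>j\<in>UNIV. (u - l) $ j)"
    using prod.reindex_bij_betw[of "inv r" UNIV UNIV "\<lambda>j. (u - l) $ j"] assms
    by (simp add: bij_imp_bij_inv)
  also have "\<dots> = emeasure lborel (box l u)"
    using le by (simp add: emeasure_lborel_box_cart)
  finally show "emeasure (distr lborel borel (vec_reindex r)) (box l u) = (\<Prod>b\<in>Basis. (u - l) \<bullet> b)"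
    using box_le by (simp add: emeasure_lborel_box_eq)
qed simp

lemma
  fixes r :: "'m::finite \<Rightarrow> 'n::finite"
  assumes "bij r" and "p permutes UNIV"
  shows permutes_bij_conj: "r \<circ> p \<circ> inv r permutes UNIV"
    and sign_bij_conj: "sign (r \<circ> p \<circ> inv r) = sign p"
proof -
  interpret permutes_bij_finite p UNIV UNIV r "inv r" "r \<circ> p \<circ> inv r"
    using assms by unfold_locales (auto simp: bij_is_inj intro!: eq_reflection)
  show "r \<circ> p \<circ> inv r permutes UNIV" "sign (r \<circ> p \<circ> inv r) = sign p"
    using permutes_p' sign_p' by simp_all
qed

lemma det_vec_reindex:
  fixes M :: "'a::comm_ring_1^'n::finite^'n" and r :: "'m::finite \<Rightarrow> 'n"
  assumes "bij r"
  shows "det (\<chi> i j. M $ r i $ r j) = det M"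
proof -
  let ?conj = "\<lambda>p. r \<circ> p \<circ> inv r"
  have "bij_betw ?conj {p. p permutes UNIV} {q. q permutes UNIV}"
  proof (rule bij_betw_byWitness[where f' = "\<lambda>q. inv r \<circ> q \<circ> r"])
    show "?conj ` {p. p permutes UNIV} \<subseteq> {q. q permutes UNIV}"
      using permutes_bij_conj[OF assms] by blast
    show "(\<lambda>q. inv r \<circ> q \<circ> r) ` {q. q permutes UNIV} \<subseteq> {p. p permutes UNIV}"
      using permutes_bij_conj[OF bij_imp_bij_inv[OF assms]] assms by (auto simp: inv_inv_eq)
  qed (use assms in \<open>auto simp: fun_eq_iff bij_is_inj bij_is_surj surj_f_inv_f\<close>)
  then have "det M = (\<Sum>p | p permutes UNIV. of_int (sign (?conj p)) * (\<Prod>k\<in>UNIV. M $ k $ ?conj p k))"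
    unfolding det_def
    by (simp add: sum.reindex_bij_betw[symmetric, of _ _ _ "\<lambda>q. of_int (sign q) * (\<Prod>k\<in>UNIV. M $ k $ q k)"])
  also have "\<dots> = (\<Sum>p | p permutes UNIV. of_int (sign p) * (\<Prod>i\<in>UNIV. M $ r i $ r (p i)))"
  proof (intro sum.cong refl)
    fix p :: "'m \<Rightarrow> 'm" assume "p \<in> {p. p permutes UNIV}"
    moreover have "(\<Prod>k\<in>UNIV. M $ k $ ?conj p k) = (\<Prod>i\<in>UNIV. M $ r i $ r (p i))"
      using prod.reindex_bij_betw[of r UNIV UNIV "\<lambda>k. M $ k $ ?conj p k"] assms
      by (simp add: bij_is_inj)
    ultimately show "of_int (sign (?conj p)) * (\<Prod>k\<in>UNIV. M $ k $ ?conj p k)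
        = of_int (sign p) * (\<Prod>i\<in>UNIV. M $ r i $ r (p i))"
      using sign_bij_conj[OF assms] by simp
  qed
  also have "\<dots> = det (\<chi> i j. M $ r i $ r j)"
    by (simp add: det_def)
  finally show ?thesis ..
qed

lemma matrix_mul_matrix_inv:
  fixes A :: "'a::field^'n::finite^'n"
  assumes "invertible A"
  shows "A ** matrix_inv A = mat 1" and "matrix_inv A ** A = mat 1"
  using someI_ex[OF assms[unfolded invertible_def]] by (simp_all add: matrix_inv_def)

lemma abs_det_matrix_inv:
  fixes A :: "real^'n::finite^'n"
  assumes "invertible A"
  shows "\<bar>det A\<bar> * \<bar>det (matrix_inv A)\<bar> = 1"
  using det_mul[of A "matrix_inv A"] matrix_mul_matrix_inv(1)[OF assms] by (simp flip: abs_mult)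

lemma vimage_matrix_vector_mult:
  fixes A :: "'a::field^'n::finite^'n"
  assumes "invertible A"
  shows "(*v) A -` S = (*v) (matrix_inv A) ` S"
  using matrix_mul_matrix_inv[OF assms]
  by (force simp: matrix_vector_mul_assoc image_iff)

lemma borel_measurable_matrix_vector_mult [measurable]:
  "((*v) A :: real^'n::finite \<Rightarrow> real^'m::finite) \<in> borel_measurable borel"
  by (intro borel_measurable_continuous_onI linear_continuous_on) simp

text \<open>The change-of-variables theorems of HOL-Analysis require an index type of sort
  \<open>{finite, wellorder}\<close>; a well-ordered copy of an arbitrary finite index type lets us
  transport them.\<close>

typedef 'a wellordered_copy = "UNIV :: 'a set" by simp

instance wellordered_copy :: (finite) finite
  by standard (simp add: type_definition.univ[OF type_definition_wellordered_copy])

instantiation wellordered_copy :: (finite) wellorder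
begin

definition less_eq_wellordered_copy :: "'a wellordered_copy \<Rightarrow> 'a wellordered_copy \<Rightarrow> bool" where
  "x \<le> y \<longleftrightarrow> to_nat (Rep_wellordered_copy x) \<le> to_nat (Rep_wellordered_copy y)"

definition less_wellordered_copy :: "'a wellordered_copy \<Rightarrow> 'a wellordered_copy \<Rightarrow> bool" where
  "x < y \<longleftrightarrow> to_nat (Rep_wellordered_copy x) < to_nat (Rep_wellordered_copy y)"

instance
proof
  fix x y z :: "'a wellordered_copy"
  show "x \<le> y \<Longrightarrow> y \<le> x \<Longrightarrow> x = y"
    by (simp add: less_eq_wellordered_copy_def Rep_wellordered_copy_inject)
  fix P :: "'a wellordered_copy \<Rightarrow> bool"
  assume step: "\<And>x. (\<And>y. y < x \<Longrightarrow> P y) \<Longrightarrow> P x"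
  show "P x"
    by (induct x rule: measure_induct_rule[of "\<lambda>x. to_nat (Rep_wellordered_copy x)"])
       (metis step less_wellordered_copy_def)
qed (auto simp: less_eq_wellordered_copy_def less_wellordered_copy_def)

end

lemma bij_Rep_wellordered_copy: "bij Rep_wellordered_copy"
  by (metis bijI' Rep_wellordered_copy_inject Rep_wellordered_copy_cases UNIV_I)

lemma bij_Abs_wellordered_copy: "bij Abs_wellordered_copy"
  by (metis bijI' Abs_wellordered_copy_inject Abs_wellordered_copy_cases UNIV_I)

lemma lborel_eq_density_distr_matrix_wellorder:
  fixes A :: "real^'m::{finite,wellorder}^'m::_"
  assumes "invertible A"
  shows "lborel = density (distr lborel borel ((*v) A)) (\<lambda>_. ennreal \<bar>det A\<bar>)"
proof (rule lborel_eqI)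
  fix l u :: "real^'m::_"
  assume box_le: "\<And>b. b \<in> Basis \<Longrightarrow> l \<bullet> b \<le> u \<bullet> b"
  let ?S = "(*v) A -` box l u"
  have "open ?S"
    by (intro continuous_open_vimage open_box) (simp add: linear_continuous_at)
  have S_image: "?S = (*v) (matrix_inv A) ` box l u"
    by (rule vimage_matrix_vector_mult[OF assms])
  have "emeasure lborel ?S = emeasure lebesgue ?S"
    using \<open>open ?S\<close> by simp
  also have "\<dots> = \<bar>det (matrix_inv A)\<bar> * measure lebesgue (box l u)"
    unfolding S_image
    by (simp add: emeasure_eq_measure2 measurable_linear_image measure_linear_image)
  finally have "ennreal \<bar>det A\<bar> * emeasure lborel ?S = emeasure lborel (box l u)"
    by (simp add: emeasure_eq_measure2 ennreal_mult'[symmetric] mult.assoc[symmetric]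
        abs_det_matrix_inv[OF assms])
  then show "emeasure (density (distr lborel borel ((*v) A)) (\<lambda>_. ennreal \<bar>det A\<bar>)) (box l u)
      = (\<Prod>b\<in>Basis. (u - l) \<bullet> b)"
    using box_le by (simp add: emeasure_density_const emeasure_distr emeasure_lborel_box_eq)
qed simp

lemma lborel_eq_density_distr_matrix:
  fixes A :: "real^'n::finite^'n"
  assumes "invertible A"
  shows "lborel = density (distr lborel borel ((*v) A)) (\<lambda>_. ennreal \<bar>det A\<bar>)"
proof -
  let ?B = "(\<chi> i j. A $ Rep_wellordered_copy i $ Rep_wellordered_copy j)
    :: real^'n wellordered_copy^'n wellordered_copy"
  let ?s = "vec_reindex Abs_wellordered_copy :: real^'n wellordered_copy \<Rightarrow> real^'n"
  have det_B: "det ?B = det A"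
    by (rule det_vec_reindex[OF bij_Rep_wellordered_copy])
  with assms have "invertible ?B"
    by (simp add: invertible_det_nz)
  have "A *v ?s y = ?s (?B *v y)" for y
    using sum.reindex_bij_betw[OF bij_Abs_wellordered_copy,
        of "\<lambda>j. A $ _ $ Rep_wellordered_copy j * y $ j"]
    by (simp add: vec_eq_iff vec_reindex_def matrix_vector_mult_def Abs_wellordered_copy_inverse)
  then have conj: "(*v) A \<circ> ?s = ?s \<circ> (*v) ?B"
    by (simp add: fun_eq_iff)
  have lborel_s: "distr lborel borel ?s = lborel"
    by (rule lborel_distr_vec_reindex[OF bij_Abs_wellordered_copy])
  have "density (distr lborel borel ((*v) A)) (\<lambda>_. ennreal \<bar>det A\<bar>)
      = density (distr (distr lborel borel ((*v) ?B)) borel ?s) (\<lambda>_. ennreal \<bar>det A\<bar>)"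
    by (subst (1) lborel_s[symmetric]) (simp add: distr_distr conj)
  also have "\<dots> = distr (density (distr lborel borel ((*v) ?B)) (\<lambda>_. ennreal \<bar>det ?B\<bar>)) borel ?s"
    by (simp add: density_distr det_B)
  also have "\<dots> = lborel"
    by (simp flip: lborel_eq_density_distr_matrix_wellorder[OF \<open>invertible ?B\<close>] add: lborel_s)
  finally show ?thesis ..
qed

lemma lborel_eq_density_distr_affine:
  fixes A :: "real^'n::finite^'n"
  assumes "invertible A"
  shows "lborel = density (distr lborel borel (\<lambda>x. A *v x + b)) (\<lambda>_. ennreal \<bar>det A\<bar>)"
proof -
  have "(\<lambda>x. A *v x + b) = (+) b \<circ> (*v) A"
    by (simp add: fun_eq_iff add.commute)
  then have "density (distr lborel borel (\<lambda>x. A *v x + b)) (\<lambda>_. ennreal \<bar>det A\<bar>)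
      = distr (density (distr lborel borel ((*v) A)) (\<lambda>_. ennreal \<bar>det A\<bar>)) borel ((+) b)"
    by (simp add: distr_distr density_distr)
  also have "\<dots> = lborel"
    by (simp flip: lborel_eq_density_distr_matrix[OF assms] add: lborel_distr_plus)
  finally show ?thesis ..
qed

lemma integral_affine_comp:
  fixes A :: "real^'n::finite^'n" and f :: "real^'n \<Rightarrow> real"
  assumes "invertible A" and [measurable]: "f \<in> borel_measurable borel"
  shows "(\<integral>x. \<bar>det A\<bar> * f (A *v x + b) \<partial>lborel) = (\<integral>x. f x \<partial>lborel)"
proof -
  have "(\<integral>x. f x \<partial>lborel)
      = integral\<^sup>L (density (distr lborel borel (\<lambda>x. A *v x + b)) (\<lambda>_. ennreal \<bar>det A\<bar>)) f"
    by (simp flip: lborel_eq_density_distr_affine[OF assms(1)])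
  also have "\<dots> = (\<integral>x. \<bar>det A\<bar> * f (A *v x + b) \<partial>lborel)"
    by (simp add: integral_density integral_distr)
  finally show ?thesis ..
qed

section \<open>Moments of an affinely transformed density\<close>

text \<open>If \<theta> has density p and \<theta> = A \<theta>' + b, then \<theta>' has density
  \<open>affine_pullback A b p\<close>; for p = \<pi>_\<tau> this is the paper's \<pi>_\<tau> with a bar.\<close>

definition affine_pullback :: "real^'n^'n \<Rightarrow> real^'n \<Rightarrow> (real^'n \<Rightarrow> real) \<Rightarrow> real^'n \<Rightarrow> real" where
  "affine_pullback A b p x = p (A *v x + b) * \<bar>det A\<bar>"

lemma expect_affine_pullback:
  fixes A :: "real^'n::finite^'n"
  assumes "invertible A" and "integrable lborel (\<lambda>y. p y * f y)"
  shows "expect (affine_pullback A b p) (\<lambda>x. f (A *v x + b)) = expect p f"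
proof -
  have "(\<lambda>y. p y * f y) \<in> borel_measurable borel"
    using borel_measurable_integrable[OF assms(2)] by simp
  from integral_affine_comp[OF assms(1) this] show ?thesis
    by (simp add: expect_def affine_pullback_def mult_ac)
qed

lemma first_moment_expansion:
  fixes M :: "real^'n::finite^'m::finite"
  shows "p y * (M *v (y - c)) $ i = (\<Sum>k\<in>UNIV. M $ i $ k * (p y * y $ k)) - (M *v c) $ i * p y"
  by (simp add: matrix_vector_mult_def sum_distrib_left sum_distrib_right algebra_simps
      flip: sum_subtractf)

lemma
  fixes p :: "real^'n::finite \<Rightarrow> real" and M :: "real^'n^'m::finite"
  assumes "integrable lborel p" and "\<And>k. integrable lborel (\<lambda>y. p y * y $ k)"
  shows integrable_first_moment: "integrable lborel (\<lambda>y. p y * (M *v (y - c)) $ i)"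
    and expect_first_moment: "(\<integral>y. p y \<partial>lborel) = 1 \<Longrightarrow>
      expect p (\<lambda>y. (M *v (y - c)) $ i) = (M *v (mean p - c)) $ i"
proof -
  show "integrable lborel (\<lambda>y. p y * (M *v (y - c)) $ i)"
    unfolding first_moment_expansion using assms by simp
  assume "(\<integral>y. p y \<partial>lborel) = 1"
  then have "expect p (\<lambda>y. (M *v (y - c)) $ i) = (\<Sum>k\<in>UNIV. M $ i $ k * mean p $ k) - (M *v c) $ i"
    unfolding expect_def first_moment_expansion using assms by (simp add: mean_def expect_def)
  also have "\<dots> = (M *v (mean p - c)) $ i"
    by (simp add: matrix_vector_mult_def right_diff_distrib sum_subtractf)
  finally show "expect p (\<lambda>y. (M *v (y - c)) $ i) = (M *v (mean p - c)) $ i" .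
qed

lemma second_moment_expansion:
  fixes M :: "real^'n::finite^'m::finite"
  shows "p y * ((M *v (y - c)) $ i * (M *v (y - c)) $ j)
    = (\<Sum>k\<in>UNIV. \<Sum>l\<in>UNIV. M $ i $ k * M $ j $ l * (p y * ((y $ k - c $ k) * (y $ l - c $ l))))"
  by (subst sum.swap) (simp add: matrix_vector_mult_def sum_product sum_distrib_left mult_ac)

lemma integrable_centered_second_moment:
  fixes p :: "real^'n::finite \<Rightarrow> real"
  assumes "integrable lborel p" and "\<And>k. integrable lborel (\<lambda>y. p y * y $ k)"
    and "\<And>k l. integrable lborel (\<lambda>y. p y * (y $ k * y $ l))"
  shows "integrable lborel (\<lambda>y. p y * ((y $ k - c $ k) * (y $ l - c $ l)))"
proof -
  have "(\<lambda>y. p y * ((y $ k - c $ k) * (y $ l - c $ l)))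
      = (\<lambda>y. p y * (y $ k * y $ l) - c $ l * (p y * y $ k) - c $ k * (p y * y $ l) + c $ k * c $ l * p y)"
    by (simp add: fun_eq_iff algebra_simps)
  then show ?thesis
    using assms by simp
qed

lemma
  fixes p :: "real^'n::finite \<Rightarrow> real" and M :: "real^'n^'m::finite"
  assumes "integrable lborel p" and "\<And>k. integrable lborel (\<lambda>y. p y * y $ k)"
    and "\<And>k l. integrable lborel (\<lambda>y. p y * (y $ k * y $ l))"
  shows integrable_second_moment:
      "integrable lborel (\<lambda>y. p y * ((M *v (y - c)) $ i * (M *v (y - c)) $ j))"
    and expect_second_moment:
      "expect p (\<lambda>y. (M *v (y - mean p)) $ i * (M *v (y - mean p)) $ j)
        = (M ** cov p ** transpose M) $ i $ j"
proof -
  note centered = integrable_centered_second_moment[OF assms]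
  show "integrable lborel (\<lambda>y. p y * ((M *v (y - c)) $ i * (M *v (y - c)) $ j))"
    unfolding second_moment_expansion using centered by simp
  have "expect p (\<lambda>y. (M *v (y - mean p)) $ i * (M *v (y - mean p)) $ j)
      = (\<Sum>k\<in>UNIV. \<Sum>l\<in>UNIV. M $ i $ k * M $ j $ l * cov p $ k $ l)"
    unfolding expect_def second_moment_expansion using centered by (simp add: cov_def expect_def)
  also have "\<dots> = (M ** cov p ** transpose M) $ i $ j"
    by (simp add: matrix_matrix_mult_def transpose_def sum_distrib_left sum_distrib_right mult_ac)
      (rule sum.swap)
  finally show "expect p (\<lambda>y. (M *v (y - mean p)) $ i * (M *v (y - mean p)) $ j)
      = (M ** cov p ** transpose M) $ i $ j" .
qed

lemma mean_affine_pullback: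
  fixes A :: "real^'n::finite^'n"
  assumes A: "invertible A" and "integrable lborel p" and "(\<integral>y. p y \<partial>lborel) = 1"
    and "\<And>k. integrable lborel (\<lambda>y. p y * y $ k)"
  shows "mean (affine_pullback A b p) = matrix_inv A *v (mean p - b)"
proof -
  have coord: "(\<lambda>x. x $ i) = (\<lambda>x. (matrix_inv A *v (A *v x + b - b)) $ i)" for i
    by (simp only: add_diff_cancel_right' matrix_vector_mul_assoc matrix_mul_matrix_inv(2)[OF A]
        matrix_vector_mul_lid)
  have "mean (affine_pullback A b p) $ i = expect p (\<lambda>y. (matrix_inv A *v (y - b)) $ i)" for i
    unfolding mean_def vec_lambda_beta coord
    by (rule expect_affine_pullback[OF A integrable_first_moment[OF assms(2,4)]])
  then show ?thesis
    by (simp add: vec_eq_iff expect_first_moment[OF assms(2,4,3)])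
qed

lemma cov_affine_pullback:
  fixes A :: "real^'n::finite^'n"
  assumes A: "invertible A" and "integrable lborel p" and "(\<integral>y. p y \<partial>lborel) = 1"
    and "\<And>k. integrable lborel (\<lambda>y. p y * y $ k)"
    and "\<And>k l. integrable lborel (\<lambda>y. p y * (y $ k * y $ l))"
  shows "cov (affine_pullback A b p) = matrix_inv A ** cov p ** transpose (matrix_inv A)"
proof -
  let ?Ai = "matrix_inv A"
  have centered: "x - mean (affine_pullback A b p) = ?Ai *v (A *v x + b - mean p)" for x
    by (simp add: mean_affine_pullback[OF assms(1-4)] matrix_vector_mult_diff_distrib
        matrix_vector_right_distrib matrix_vector_mul_assoc matrix_mul_matrix_inv(2)[OF A])
  have "cov (affine_pullback A b p) $ i $ j
      = expect p (\<lambda>y. (?Ai *v (y - mean p)) $ i * (?Ai *v (y - mean p)) $ j)" for i j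
    unfolding cov_def vec_lambda_beta vector_minus_component[symmetric] centered
    by (rule expect_affine_pullback[OF A integrable_second_moment[OF assms(2,4,5)]])
  then show ?thesis
    by (simp add: vec_eq_iff expect_second_moment[OF assms(2,4,5)])
qed

section \<open>Gradient and divergence under affine changes of variables\<close>

lemma has_derivative_affine_comp:
  fixes f :: "real^'n::finite \<Rightarrow> 'a::real_normed_vector" and A :: "real^'n^'n"
  assumes "(f has_derivative D) (at (A *v x + b))"
  shows "((\<lambda>x. f (A *v x + b)) has_derivative (\<lambda>h. D (A *v h))) (at x)"
proof -
  have "((\<lambda>x. A *v x + b) has_derivative (*v) A) (at x)"
    by (auto intro!: derivative_eq_intros bounded_linear_imp_has_derivative)
  from has_derivative_compose[OF this assms] show ?thesis .
qed

lemma frechet_derivative_affine_comp: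
  fixes f :: "real^'n::finite \<Rightarrow> 'a::real_normed_vector" and A :: "real^'n^'n"
  assumes "f differentiable (at (A *v x + b))"
  shows "frechet_derivative (\<lambda>x. f (A *v x + b)) (at x)
    = (\<lambda>h. frechet_derivative f (at (A *v x + b)) (A *v h))"
  using has_derivative_affine_comp[OF assms[unfolded frechet_derivative_works]]
  by (rule frechet_derivative_at[symmetric])

lemma frechet_derivative_eq_inner_grad:
  fixes V :: "real^'n::finite \<Rightarrow> real"
  assumes "V differentiable (at y)"
  shows "frechet_derivative V (at y) h = grad V y \<bullet> h"
proof -
  have "linear (frechet_derivative V (at y))"
    using assms by (simp add: frechet_derivative_works has_derivative_linear)
  then have "frechet_derivative V (at y) (\<Sum>k\<in>UNIV. h $ k *\<^sub>R axis k 1)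
      = (\<Sum>k\<in>UNIV. h $ k * frechet_derivative V (at y) (axis k 1))"
    by (simp add: linear_sum linear_scale)
  moreover have "(\<Sum>k\<in>UNIV. h $ k *\<^sub>R axis k 1) = h"
    using basis_expansion[of h] by (simp add: scalar_mult_eq_scaleR)
  ultimately show ?thesis
    by (simp add: grad_def inner_vec_def mult.commute)
qed

lemma grad_affine_comp:
  fixes V :: "real^'n::finite \<Rightarrow> real" and A :: "real^'n^'n"
  assumes "V differentiable (at (A *v x + b))"
  shows "grad (\<lambda>x. V (A *v x + b)) x = transpose A *v grad V (A *v x + b)"
  using assms
  by (simp add: vec_eq_iff grad_def[of "\<lambda>x. V (A *v x + b)"] frechet_derivative_affine_comp
      frechet_derivative_eq_inner_grad dot_lmul_matrix[symmetric] inner_axis)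

lemma divergence_eq_trace_jacobian: "divergence G x = trace (jacobian G (at x))"
  by (simp add: divergence_def trace_def jacobian_def matrix_def)

lemma divergence_scaleR:
  fixes G :: "real^'n::finite \<Rightarrow> real^'n"
  assumes "G differentiable (at x)"
  shows "divergence (\<lambda>x. c *\<^sub>R G x) x = c * divergence G x"
proof -
  have "((\<lambda>x. c *\<^sub>R G x) has_derivative (\<lambda>h. c *\<^sub>R frechet_derivative G (at x) h)) (at x)"
    using assms by (auto simp: frechet_derivative_works intro!: derivative_eq_intros)
  then show ?thesis
    by (simp add: divergence_def frechet_derivative_at[symmetric] sum_distrib_left)
qed

lemma
  fixes G :: "real^'n::finite \<Rightarrow> real^'n" and A M :: "real^'n^'n"
  assumes "G differentiable (at (A *v x + b))" and "A ** M = mat 1"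
  shows differentiable_matrix_affine_conj: "(\<lambda>x. M *v G (A *v x + b)) differentiable (at x)"
    and divergence_matrix_affine_conj:
      "divergence (\<lambda>x. M *v G (A *v x + b)) x = divergence G (A *v x + b)"
proof -
  let ?J = "jacobian G (at (A *v x + b))"
  have "((\<lambda>x. M *v G (A *v x + b)) has_derivative (\<lambda>h. (M ** ?J ** A) *v h)) (at x)"
    using bounded_linear.has_derivative[OF matrix_vector_mul_bounded_linear
        has_derivative_affine_comp[OF assms(1)[unfolded jacobian_works]], of M]
    by (simp add: matrix_vector_mul_assoc matrix_mul_assoc)
  then show "(\<lambda>x. M *v G (A *v x + b)) differentiable (at x)"
    and "divergence (\<lambda>x. M *v G (A *v x + b)) x = divergence G (A *v x + b)"
    using trace_mul_sym[of "M ** ?J" A] assms(2)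
    by (auto simp: differentiableI divergence_eq_trace_jacobian jacobian_def
        frechet_derivative_at[symmetric] matrix_mul_assoc)
qed

section \<open>Affine invariance of the homotopy vector field\<close>

lemma Fvec_affine_pullback:
  fixes A :: "real^'n::finite^'n"
  assumes A: "invertible A" and "integrable lborel p" and "(\<integral>y. p y \<partial>lborel) = 1"
    and "\<And>k. integrable lborel (\<lambda>y. p y * y $ k)"
    and "\<And>k l. integrable lborel (\<lambda>y. p y * (y $ k * y $ l))"
    and "V differentiable (at (A *v x + b))"
  shows "Fvec (affine_pullback A b p) (\<lambda>x. V (A *v x + b)) x = matrix_inv A *v Fvec p V (A *v x + b)"
proof -
  have "M ** transpose (matrix_inv A) ** transpose A = M" for M :: "real^'n^'n"
    by (simp add: matrix_mul_assoc[symmetric] matrix_transpose_mul[symmetric]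
        matrix_mul_matrix_inv(1)[OF A])
  then show ?thesis
    by (simp add: Fvec_def cov_affine_pullback[OF assms(1-5)] grad_affine_comp[OF assms(6)]
        matrix_vector_mul_assoc matrix_mul_assoc del: transpose_matrix_vector)
qed

lemma solves_pde_affine_pullback:
  fixes A :: "real^'n::finite^'n"
  assumes A: "invertible A" and p: "integrable lborel p" "(\<integral>y. p y \<partial>lborel) = 1"
    and p_k: "\<And>k. integrable lborel (\<lambda>y. p y * y $ k)"
    and p_kl: "\<And>k l. integrable lborel (\<lambda>y. p y * (y $ k * y $ l))"
    and Psi: "integrable lborel (\<lambda>y. p y * Psi y)"
    and pde: "solves_pde Psi p V"
  shows "solves_pde (\<lambda>x. Psi (A *v x + b)) (affine_pullback A b p) (\<lambda>x. V (A *v x + b))"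
proof -
  let ?Ai = "matrix_inv A"
  define G where "G y = p y *\<^sub>R Fvec p V y" for y
  have V_diff: "V differentiable (at y)" and G_diff: "G differentiable (at y)"
    and div_G: "divergence G y = - (Psi y - expect p Psi) * p y" for y
    using pde by (simp_all add: solves_pde_def G_def[abs_def])
  have flux: "(\<lambda>x. affine_pullback A b p x *\<^sub>R Fvec (affine_pullback A b p) (\<lambda>x. V (A *v x + b)) x)
      = (\<lambda>x. \<bar>det A\<bar> *\<^sub>R (?Ai *v G (A *v x + b)))"
    by (simp add: fun_eq_iff Fvec_affine_pullback[OF A p p_k p_kl V_diff] affine_pullback_def
        G_def matrix_vector_mult_scaleR)
  have conj: "A ** ?Ai = mat 1"
    by (rule matrix_mul_matrix_inv(1)[OF A])
  show ?thesis
    unfolding solves_pde_def flux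
  proof (intro conjI allI)
    fix x
    show "(\<lambda>x. V (A *v x + b)) differentiable (at x)"
      using V_diff[of "A *v x + b"] unfolding differentiable_def
      by (blast intro: has_derivative_affine_comp)
    show "(\<lambda>x. \<bar>det A\<bar> *\<^sub>R (?Ai *v G (A *v x + b))) differentiable (at x)"
      using differentiable_matrix_affine_conj[OF G_diff conj] by simp
    have "divergence (\<lambda>x. \<bar>det A\<bar> *\<^sub>R (?Ai *v G (A *v x + b))) x
        = \<bar>det A\<bar> * divergence G (A *v x + b)"
      by (simp add: divergence_scaleR differentiable_matrix_affine_conj[OF G_diff conj]
          divergence_matrix_affine_conj[OF G_diff conj])
    also have "\<dots> = - (Psi (A *v x + b) - expect (affine_pullback A b p) (\<lambda>x. Psi (A *v x + b)))
        * affine_pullback A b p x"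
      by (simp add: div_G expect_affine_pullback[OF A Psi] affine_pullback_def)
    finally show "divergence (\<lambda>x. \<bar>det A\<bar> *\<^sub>R (?Ai *v G (A *v x + b))) x
        = - (Psi (A *v x + b) - expect (affine_pullback A b p) (\<lambda>x. Psi (A *v x + b)))
          * affine_pullback A b p x" .
  qed
qed

lemma
  fixes Psi_data Psi_prior :: "real^'n::finite \<Rightarrow> real"
  assumes "integrable lborel (\<lambda>\<theta>. exp (- \<tau> * Psi_data \<theta> - Psi_prior \<theta>))"
  shows integrable_post: "integrable lborel (post Psi_data Psi_prior \<tau>)"
    and integral_post: "(\<integral>\<theta>. post Psi_data Psi_prior \<tau> \<theta> \<partial>lborel) = 1"
proof -
  let ?Z = "\<integral>\<theta>. exp (- \<tau> * Psi_data \<theta> - Psi_prior \<theta>) \<partial>lborel"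
  show "integrable lborel (post Psi_data Psi_prior \<tau>)"
    using assms by (simp add: post_def[abs_def])
  have "?Z \<noteq> 0"
  proof
    assume "?Z = 0"
    then have "AE \<theta> in lborel. exp (- \<tau> * Psi_data \<theta> - Psi_prior \<theta>) = 0"
      using integral_nonneg_eq_0_iff_AE[OF assms] by simp
    then have "AE \<theta> in (lborel :: (real^'n) measure). False"
      by simp
    then show False
      by (simp add: eventually_False ae_filter_eq_bot_iff)
  qed
  then show "(\<integral>\<theta>. post Psi_data Psi_prior \<tau> \<theta> \<partial>lborel) = 1"
    by (simp add: post_def)
qed

theorem mainTheorem1:
  fixes Psi_data Psi_prior V :: "real^'n \<Rightarrow> real"
    and \<tau> :: real and A :: "real^'n^'n" and b :: "real^'n"
  assumes "0 \<le> \<tau>" and "\<tau> \<le> 1"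
    and "integrable lborel (\<lambda>\<theta>. exp (- \<tau> * Psi_data \<theta> - Psi_prior \<theta>))"
    and "\<forall>i. integrable lborel (\<lambda>\<theta>. post Psi_data Psi_prior \<tau> \<theta> * \<theta> $ i)"
    and "\<forall>i j. integrable lborel (\<lambda>\<theta>. post Psi_data Psi_prior \<tau> \<theta> * (\<theta> $ i * \<theta> $ j))"
    and "integrable lborel (\<lambda>\<theta>. post Psi_data Psi_prior \<tau> \<theta> * Psi_data \<theta>)"
    and "solves_pde Psi_data (post Psi_data Psi_prior \<tau>) V"
    and "invertible A"
  shows "solves_pde (\<lambda>\<theta>b. Psi_data (A *v \<theta>b + b))
            (\<lambda>\<theta>b. post Psi_data Psi_prior \<tau> (A *v \<theta>b + b) * \<bar>det A\<bar>)
            (\<lambda>\<theta>b. V (A *v \<theta>b + b))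
       \<and> (\<forall>\<theta>b. Fvec (post Psi_data Psi_prior \<tau>) V (A *v \<theta>b + b) =
               A *v Fvec (\<lambda>x. post Psi_data Psi_prior \<tau> (A *v x + b) * \<bar>det A\<bar>)
                         (\<lambda>x. V (A *v x + b)) \<theta>b)"
proof -
  let ?p = "post Psi_data Psi_prior \<tau>"
  note density = integrable_post[OF assms(3)] integral_post[OF assms(3)]
  note moments = assms(4,5)[rule_format]
  have V_diff: "V differentiable (at y)" for y
    using assms(7) by (simp add: solves_pde_def)
  have pullback: "(\<lambda>\<theta>b. ?p (A *v \<theta>b + b) * \<bar>det A\<bar>) = affine_pullback A b ?p"
    by (simp add: fun_eq_iff affine_pullback_def)
  have "Fvec ?p V (A *v \<theta>b + b) = A *v Fvec (affine_pullback A b ?p) (\<lambda>x. V (A *v x + b)) \<theta>b"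
    for \<theta>b
    by (simp add: Fvec_affine_pullback[OF assms(8) density moments V_diff] matrix_vector_mul_assoc
        matrix_mul_matrix_inv(1)[OF assms(8)])
  then show ?thesis
    unfolding pullback using solves_pde_affine_pullback[OF assms(8) density moments assms(6,7)]
    by simp
qed

end
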